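(* Let $X$ be a real Hilbert space. For $\psi:(0,\infty)\to(0,\infty)$ and $\varepsilon>0$ define $$\gamma_\psi(\varepsilon) := \min\left(\frac{\psi(\varepsilon)}{L_\psi(\varepsilon)}, \varepsilon \right),$$ with $L_\psi$ as defined in the context. Let $\psi:(0,\infty) \to (0,\infty)$ and let $A$ be a maximally monotone operator on $X$ which is inverse uniformly monotone with modulus $\psi$. Then, for all $\varepsilon>0$ and $x,y \in X$ with $\|x-y\|<\gamma_\psi(\varepsilon)$, we have that $\|Ax-Ay\| < \varepsilon$ (that is, $\gamma_\psi$ is a modulus of uniform continuity for $A$).
   Context: Let $X$ be a real Hilbert space. A set-valued operator $A\subseteq X\times X$ is monotone if $\langle a-c,b-d\rangle\ge0$ for all $(a,b),(c,d)\in A$; it is maximally monotone if it is maximal among monotone operators with respect to inclusion. $A$ is uniformly monotone with modulus $\psi:(0,\infty)\to(0,\infty)$ if for all $\varepsilon>0$ and all $(a,b),(c,d)\in A$ with $\|a-c\|\ge\varepsilon$, $\psi(\varepsilon)\le\langle a-c,b-d\rangle$; $A$ is inverse uniformly monotone with modulus $\psi$ if $A^{-1}=\{(b,a)\mid(a,b)\in A\}$ is uniformly monotone with modulus $\psi$. It is known (Liu, Moursi, Vanderwerff) that a maximally monotone and inverse uniformly monotone $A$ is a single-valued mapping defined on the whole of $X$; one writes $A:X\to X$ and $Ax$ for its value at $x$. For $\psi,\alpha:(0,\infty)\to(0,\infty)$ and $\varepsilon>0$ put $$\alpha_\psi(\varepsilon):=\min\left(\psi(\varepsilon/2),\varepsilon^2/4\right),$$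 $$\beta_\alpha(\varepsilon):=\min(\alpha(1)/4,\alpha(\varepsilon))\text{ if }\varepsilon<1,\qquad \beta_\alpha(\varepsilon):=\alpha(1)/4\text{ if }\varepsilon\ge1,$$ $$L_\psi(\varepsilon):=\max\left(\frac{4\varepsilon}{\sqrt{1+4\beta_{\alpha_\psi}(\varepsilon)}-1},2\varepsilon\right).$$ *)

theory Defs
  imports "HOL-Analysis.Analysis"
begin

text \<open>
  A real Hilbert space is a type of sort \<open>{real_inner, complete_space}\<close>; a set-valued operator
  on it is identified with its graph. Functions \<open>(0,\<infinity>) \<rightarrow> (0,\<infinity>)\<close> are modelled as functions
  \<open>real \<Rightarrow> real\<close>, of which only the values at positive arguments matter; their positivity there
  is stated as a separate assumption wherever a modulus is introduced.
\<close>

definition monotone_op :: "('a::real_inner \<times> 'a) set \<Rightarrow> bool" where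
  "monotone_op A \<longleftrightarrow> (\<forall>(a, b) \<in> A. \<forall>(c, d) \<in> A. (a - c) \<bullet> (b - d) \<ge> 0)"

definition maximally_monotone :: "('a::real_inner \<times> 'a) set \<Rightarrow> bool" where
  "maximally_monotone A \<longleftrightarrow> monotone_op A \<and> (\<forall>B. monotone_op B \<and> A \<subseteq> B \<longrightarrow> B = A)"

definition uniformly_monotone :: "(real \<Rightarrow> real) \<Rightarrow> ('a::real_inner \<times> 'a) set \<Rightarrow> bool" where
  "uniformly_monotone \<psi> A \<longleftrightarrow>
     (\<forall>\<epsilon>>0. \<forall>(a, b) \<in> A. \<forall>(c, d) \<in> A. norm (a - c) \<ge> \<epsilon> \<longrightarrow> \<psi> \<epsilon> \<le> (a - c) \<bullet> (b - d))"

definition inverse_uniformly_monotone :: "(real \<Rightarrow> real) \<Rightarrow> ('a::real_inner \<times> 'a) set \<Rightarrow> bool" where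
  "inverse_uniformly_monotone \<psi> A \<longleftrightarrow> uniformly_monotone \<psi> (A\<inverse>)"

text \<open>
  The value \<open>A x\<close> is meaningful only when \<open>A\<close> has exactly one value at \<open>x\<close>. Maximally monotone,
  inverse uniformly monotone operators have this property at every point (Liu, Moursi,
  Vanderwerff).
\<close>

definition op_value :: "('a \<times> 'a) set \<Rightarrow> 'a \<Rightarrow> 'a" where
  "op_value A x = (THE u. (x, u) \<in> A)"

definition \<alpha>_mod :: "(real \<Rightarrow> real) \<Rightarrow> real \<Rightarrow> real" where
  "\<alpha>_mod \<psi> \<epsilon> = min (\<psi> (\<epsilon> / 2)) (\<epsilon>\<^sup>2 / 4)"

definition \<beta>_mod :: "(real \<Rightarrow> real) \<Rightarrow> real \<Rightarrow> real" where
  "\<beta>_mod \<alpha> \<epsilon> = (if \<epsilon> < 1 then min (\<alpha> 1 / 4) (\<alpha> \<epsilon>) else \<alpha> 1 / 4)"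

definition L_mod :: "(real \<Rightarrow> real) \<Rightarrow> real \<Rightarrow> real" where
  "L_mod \<psi> \<epsilon> = max (4 * \<epsilon> / (sqrt (1 + 4 * \<beta>_mod (\<alpha>_mod \<psi>) \<epsilon>) - 1)) (2 * \<epsilon>)"

definition \<gamma>_mod :: "(real \<Rightarrow> real) \<Rightarrow> real \<Rightarrow> real" where
  "\<gamma>_mod \<psi> \<epsilon> = min (\<psi> \<epsilon> / L_mod \<psi> \<epsilon>) \<epsilon>"

end

theory Submission
  imports Defs
begin

text \<open>
  Minty's theorem makes the resolvent \<open>x + u \<mapsto> x\<close>, for \<open>(x, u) \<in> A\<close>, a map on the whole
  space, and it is uniformly monotone with modulus \<open>\<alpha>_mod \<psi>\<close>. Cutting a segment into pieces of length
  at least 1 upgrades this to quadratic growth \<open>\<beta> \<parallel>z - w\<parallel>\<^sup>2\<close> at distances at least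
  \<open>\<epsilon>\<close>, where \<open>\<beta> = \<beta>_mod (\<alpha>_mod \<psi>) \<epsilon>\<close>. For \<open>(x, u), (y, v) \<in> A\<close> with
  \<open>\<parallel>u - v\<parallel> \<ge> \<epsilon>\<close> the ratio \<open>\<tau> = \<parallel>x - y\<parallel> / \<parallel>u - v\<parallel>\<close> then satisfies
  \<open>\<tau>\<^sup>2 + \<tau> \<ge> \<beta>\<close>. So \<open>\<parallel>u - v\<parallel>\<close> is at most a constant times \<open>\<parallel>x - y\<parallel>\<close>, which
  yields both the a priori bound needed for \<open>Domain A = UNIV\<close> (by letting \<open>\<mu> \<rightarrow> 0\<close> in
  \<open>x \<in> y + \<mu> A y\<close>) and, inserted into
  \<open>\<psi> \<epsilon> \<le> \<parallel>u - v\<parallel> \<parallel>x - y\<parallel>\<close>, the modulus of continuity.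
\<close>

section \<open>Elementary facts on monotone operators\<close>

lemma monotone_opD:
  assumes "monotone_op A" "(a, b) \<in> A" "(c, d) \<in> A"
  shows "(a - c) \<bullet> (b - d) \<ge> 0"
  using assms unfolding monotone_op_def by blast

lemma uniformly_monotoneD:
  assumes "uniformly_monotone \<psi> A" "(a, b) \<in> A" "(c, d) \<in> A" "\<epsilon> > 0" "norm (a - c) \<ge> \<epsilon>"
  shows "\<psi> \<epsilon> \<le> (a - c) \<bullet> (b - d)"
  using assms unfolding uniformly_monotone_def by blast

lemma inverse_uniformly_monotoneD:
  assumes "inverse_uniformly_monotone \<psi> A" "(a, b) \<in> A" "(c, d) \<in> A"
    and "\<epsilon> > 0" "norm (b - d) \<ge> \<epsilon>"
  shows "\<psi> \<epsilon> \<le> (b - d) \<bullet> (a - c)"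
  using assms(1)[unfolded inverse_uniformly_monotone_def] assms(2-5)
  by (auto intro: uniformly_monotoneD)

text \<open>The second hypothesis keeps the graph monotone after adjoining \<open>(x, u)\<close>, so
  by maximality the pair is already there.\<close>

lemma maximally_monotone_memI:
  assumes A: "maximally_monotone A"
    and rel: "\<And>y v. (y, v) \<in> A \<Longrightarrow> (x - y) \<bullet> (u - v) \<ge> 0"
  shows "(x, u) \<in> A"
proof -
  have rel': "(y - x) \<bullet> (v - u) \<ge> 0" if "(y, v) \<in> A" for y v
    using rel[OF that] by (simp add: inner_diff algebra_simps)
  have "monotone_op (insert (x, u) A)"
    using A rel rel' unfolding maximally_monotone_def monotone_op_def by auto
  then have "insert (x, u) A = A"
    using A unfolding maximally_monotone_def by blast
  then show ?thesis by blast
qed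

lemma maximally_monotone_nonempty:
  assumes "maximally_monotone A"
  shows "A \<noteq> {}"
  using maximally_monotone_memI[OF assms, of 0 0] by auto

text \<open>Reduces \<open>x + \<mu> *\<^sub>R u = z\<close> to the case \<open>z = 0\<close>,
  \<open>\<mu> = 1\<close>. The map is invertible and multiplies the monotonicity products by
  \<open>\<mu> > 0\<close>, so monotone extensions of the image pull back.\<close>

lemma maximally_monotone_scale_translate:
  assumes A: "maximally_monotone A" and "\<mu> > 0"
  shows "maximally_monotone ((\<lambda>(x, u). (x - z, \<mu> *\<^sub>R u)) ` A)"
    (is "maximally_monotone (?f ` A)")
proof -
  have "0 \<le> (a - c) \<bullet> (\<mu> *\<^sub>R b - \<mu> *\<^sub>R d)" if "(a, b) \<in> A" "(c, d) \<in> A" for a b c d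
    using monotone_opD[OF _ that] A \<open>\<mu> > 0\<close>
    by (simp add: maximally_monotone_def flip: scaleR_diff_right)
  then have "monotone_op (?f ` A)"
    unfolding monotone_op_def by auto
  moreover have "B = ?f ` A" if B: "monotone_op B" and sub: "?f ` A \<subseteq> B" for B
  proof -
    have "(x, u) \<in> ?f ` A" if "(x, u) \<in> B" for x u
    proof -
      have "(x + z, (1/\<mu>) *\<^sub>R u) \<in> A"
      proof (rule maximally_monotone_memI[OF A])
        fix y v assume "(y, v) \<in> A"
        then have "(y - z, \<mu> *\<^sub>R v) \<in> B" using sub by force
        from monotone_opD[OF B \<open>(x, u) \<in> B\<close> this]
        have "0 \<le> (1/\<mu>) * ((x - (y - z)) \<bullet> (u - \<mu> *\<^sub>R v))" using \<open>\<mu> > 0\<close> by simp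
        also have "\<dots> = (x + z - y) \<bullet> ((1/\<mu>) *\<^sub>R u - v)"
          using \<open>\<mu> > 0\<close> by (simp add: inner_diff inner_add field_simps)
        finally show "0 \<le> (x + z - y) \<bullet> ((1/\<mu>) *\<^sub>R u - v)" .
      qed
      moreover have "?f (x + z, (1/\<mu>) *\<^sub>R u) = (x, u)" using \<open>\<mu> > 0\<close> by simp
      ultimately show ?thesis by (metis (no_types, lifting) imageI)
    qed
    then show ?thesis using sub by auto
  qed
  ultimately show ?thesis unfolding maximally_monotone_def by blast
qed

subsection \<open>Minty's theorem\<close>

text \<open>First-order optimality for minimising \<open>r + (norm w)\<^sup>2 / 2\<close> over
  \<open>K\<close>. As \<open>K\<close> need not be closed, the infimum may not be attained, but the
  first components of a minimising sequence still converge.\<close>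

lemma variational_inequality_quadratic:
  fixes K :: "('b::{real_inner, complete_space} \<times> real) set"
  assumes "convex K" "K \<noteq> {}" and bdd: "\<And>w r. (w, r) \<in> K \<Longrightarrow> r + (norm w)\<^sup>2 / 2 \<ge> b"
  obtains w where "\<And>w' r. (w', r) \<in> K \<Longrightarrow> r + w \<bullet> w' \<ge> b + (norm w)\<^sup>2 / 2"
proof -
  define \<phi> :: "'b \<times> real \<Rightarrow> real" where "\<phi> k = snd k + (norm (fst k))\<^sup>2 / 2" for k
  define m where "m = Inf (\<phi> ` K)"
  have bb: "bdd_below (\<phi> ` K)"
    using bdd by (intro bdd_belowI[of _ b]) (auto simp: \<phi>_def)
  have m_le: "m \<le> \<phi> k" if "k \<in> K" for k
    unfolding m_def using bb that by (intro cInf_lower) auto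
  have "b \<le> m"
    unfolding m_def using \<open>K \<noteq> {}\<close> bdd by (intro cInf_greatest) (auto simp: \<phi>_def)
  have "\<exists>k\<in>K. \<phi> k < m + 1 / Suc n" for n
    using cInf_lessD[of "\<phi> ` K" "m + 1 / Suc n"] \<open>K \<noteq> {}\<close> unfolding m_def[symmetric] by auto
  then obtain k where k: "\<And>n. k n \<in> K" "\<And>n. \<phi> (k n) < m + 1 / Suc n" by metis
  define w where "w n = fst (k n)" for n
  have close: "(norm (w i - w j))\<^sup>2 \<le> 4 * (1 / Suc i + 1 / Suc j)" for i j
  proof -
    \<comment> \<open>By the parallelogram law the value at the midpoint lies
      \<open>(norm (w i - w j))\<^sup>2 / 8\<close> below the mean of the two values, yet never
      below \<open>m\<close>.\<close>
    have "(1/2) *\<^sub>R k i + (1/2) *\<^sub>R k j \<in> K"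
      using \<open>convex K\<close> k by (intro convexD) auto
    from m_le[OF this] have "m \<le> \<phi> (k i) / 2 + \<phi> (k j) / 2 - (norm (w i - w j))\<^sup>2 / 8"
      by (simp add: \<phi>_def w_def power2_norm_eq_inner inner_simps inner_commute field_simps)
    then show ?thesis using k(2)[of i] k(2)[of j] by argo
  qed
  have "Cauchy w"
  proof (rule CauchyI)
    fix e :: real assume "e > 0"
    then obtain N where N: "8 / e\<^sup>2 < real N" using reals_Archimedean2 by blast
    have "norm (w i - w j) < e" if "N \<le> i" "N \<le> j" for i j
    proof -
      have "N > 0" using N \<open>e > 0\<close>
        by (metis divide_pos_pos less_trans of_nat_0_less_iff zero_less_numeral zero_less_power)
      have *: "1 / real (Suc l) < 1 / N" if "N \<le> l" for l
        using that \<open>N > 0\<close> by (intro divide_strict_left_mono) auto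
      have "(norm (w i - w j))\<^sup>2 < 4 * (1 / N + 1 / N)"
        using close[of i j] *[OF \<open>N \<le> i\<close>] *[OF \<open>N \<le> j\<close>] by argo
      also have "\<dots> < e\<^sup>2" using N \<open>e > 0\<close> \<open>N > 0\<close> by (simp add: field_simps)
      finally show ?thesis using \<open>e > 0\<close> by (simp add: power_less_imp_less_base)
    qed
    then show "\<exists>M. \<forall>i\<ge>M. \<forall>j\<ge>M. norm (w i - w j) < e" by blast
  qed
  then obtain v where lim: "w \<longlonglongrightarrow> v"
    using Cauchy_convergent convergent_def by blast
  have "m + (norm v)\<^sup>2 / 2 \<le> r + v \<bullet> w'" if mem: "(w', r) \<in> K" for w' r
  proof -
    \<comment> \<open>The slope at \<open>s = 0\<close> of the objective along the segment to
      \<open>(w', r)\<close> from \<open>(v, m - (norm v)\<^sup>2 / 2)\<close>.\<close>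
    define c where "c = r - m - (norm v)\<^sup>2 / 2 + v \<bullet> w'"
    have step: "0 \<le> s * c + s\<^sup>2 / 2 * (norm (w' - v))\<^sup>2" if s: "0 < s" "s < 1" for s
    proof -
      \<comment> \<open>Compare at \<open>k n\<close>, which does lie in \<open>K\<close>; its
        near-minimality costs an error \<open>1 / Suc n\<close> that vanishes in the limit.\<close>
      have "0 \<le> 1 / Suc n + s * (r - m - (norm (w n))\<^sup>2 / 2 + w n \<bullet> w')
                 + s\<^sup>2 / 2 * (norm (w' - w n))\<^sup>2" for n
      proof -
        have "(1 - s) *\<^sub>R k n + s *\<^sub>R (w', r) \<in> K"
          using \<open>convex K\<close> k mem s by (intro convexD) auto
        moreover have "(norm ((1 - s) *\<^sub>R w n + s *\<^sub>R w'))\<^sup>2 =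
            (norm (w n))\<^sup>2 + 2 * s * (w n \<bullet> w' - (norm (w n))\<^sup>2) + s\<^sup>2 * (norm (w' - w n))\<^sup>2"
          unfolding power2_norm_eq_inner
          by (simp add: inner_simps inner_commute power2_eq_square) (simp add: algebra_simps)
        ultimately have "m \<le> \<phi> (k n) + s * (r - snd (k n) + w n \<bullet> w' - (norm (w n))\<^sup>2)
                  + s\<^sup>2 / 2 * (norm (w' - w n))\<^sup>2"
          using m_le[of "(1 - s) *\<^sub>R k n + s *\<^sub>R (w', r)"]
          by (simp add: \<phi>_def w_def add_divide_distrib) (simp add: algebra_simps)
        moreover have "s * (r - snd (k n) + w n \<bullet> w' - (norm (w n))\<^sup>2)
            \<le> s * (r - m - (norm (w n))\<^sup>2 / 2 + w n \<bullet> w')"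
          using m_le[OF k(1)[of n]] s by (intro mult_left_mono) (auto simp: \<phi>_def w_def)
        ultimately show ?thesis using k(2)[of n] by linarith
      qed
      moreover have "(\<lambda>n. 1 / Suc n + s * (r - m - (norm (w n))\<^sup>2 / 2 + w n \<bullet> w')
                 + s\<^sup>2 / 2 * (norm (w' - w n))\<^sup>2)
          \<longlonglongrightarrow> 0 + s * (r - m - (norm v)\<^sup>2 / 2 + v \<bullet> w') + s\<^sup>2 / 2 * (norm (w' - v))\<^sup>2"
        by (intro tendsto_intros lim LIMSEQ_Suc[OF lim_1_over_n]) auto
      ultimately show ?thesis
        unfolding c_def using LIMSEQ_le_const by fastforce
    qed
    have "c \<ge> 0"
    proof (rule tendsto_lowerbound)
      show "((\<lambda>s. c + s / 2 * (norm (w' - v))\<^sup>2) \<longlongrightarrow> c) (at_right 0)"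
        by (rule tendsto_eq_intros refl | simp)+
      have "0 \<le> c + s / 2 * (norm (w' - v))\<^sup>2" if s: "0 < s" "s < 1" for s
      proof -
        have "0 \<le> s * (c + s / 2 * (norm (w' - v))\<^sup>2)"
          using step[OF s] by (simp add: power2_eq_square algebra_simps)
        then show ?thesis using s by (simp add: zero_le_mult_iff)
      qed
      then show "\<forall>\<^sub>F s in at_right 0. 0 \<le> c + s / 2 * (norm (w' - v))\<^sup>2"
        by (auto simp: eventually_at_right_field intro!: exI[of _ 1])
    qed simp
    then show ?thesis by (simp add: c_def)
  qed
  with \<open>b \<le> m\<close> show ?thesis by (intro that[of v]) force
qed

text \<open>Monotonicity extends from the graph to the hull one argument at a time, since with the
  other argument fixed it describes a half-space. With both arguments equal to
  \<open>((p, q), r)\<close> it gives twice the claim.\<close>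

lemma monotone_op_convex_hull_inner_le:
  assumes A: "monotone_op A"
    and pqr: "((p, q), r) \<in> convex hull ((\<lambda>(y, v). ((y, v), y \<bullet> v)) ` A)"
      (is "_ \<in> convex hull ?G")
  shows "p \<bullet> q \<le> r"
proof -
  have halfspace: "convex {((y, v), s). p \<bullet> v + y \<bullet> q \<le> r + s}" for p q :: 'a and r :: real
  proof -
    have "{((y, v), s). p \<bullet> v + y \<bullet> q \<le> r + s} = {k. ((q, p), - 1) \<bullet> k \<le> r}"
      by (auto simp: inner_commute)
    then show ?thesis by (simp add: convex_halfspace_le)
  qed
  have 1: "p \<bullet> v + y \<bullet> q \<le> r + y \<bullet> v" if "(y, v) \<in> A" for y v
  proof -
    have "((p, q), r) \<in> {((p, q), r). y \<bullet> q + p \<bullet> v \<le> y \<bullet> v + r}"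
      using pqr
    proof (rule set_mp[OF hull_minimal, rotated -1])
      show "?G \<subseteq> {((p, q), r). y \<bullet> q + p \<bullet> v \<le> y \<bullet> v + r}"
        using monotone_opD[OF A that] by (auto simp: inner_diff algebra_simps)
    qed (rule halfspace)
    then show ?thesis by simp
  qed
  have "((p, q), r) \<in> {((y, v), s). p \<bullet> v + y \<bullet> q \<le> r + s}"
    using pqr by (rule set_mp[OF hull_minimal, rotated -1]) (use 1 halfspace in auto)
  then show ?thesis by simp
qed

text \<open>On the hull \<open>p \<bullet> q \<le> r\<close>, so the quadratic objective is at least
  \<open>(norm (p + q))\<^sup>2 / 2\<close>, hence nonnegative. Its variational inequality yields a
  pair monotonically related to all of \<open>A\<close>.\<close>

lemma Minty_zero:
  fixes A :: "('a::{real_inner, complete_space} \<times> 'a) set"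
  assumes A: "maximally_monotone A"
  obtains x where "(x, - x) \<in> A"
proof -
  let ?K = "convex hull ((\<lambda>(y, v). ((y, v), y \<bullet> v)) ` A)"
  have mono: "monotone_op A" using A by (simp add: maximally_monotone_def)
  have lower: "r + (norm w)\<^sup>2 / 2 \<ge> 0" if "(w, r) \<in> ?K" for w r
  proof -
    obtain p q where w: "w = (p, q)" by force
    have "p \<bullet> q \<le> r" using monotone_op_convex_hull_inner_le[OF mono] that w by blast
    moreover have "0 \<le> (norm (p + q))\<^sup>2" by simp
    ultimately show ?thesis
      by (simp add: w power2_norm_eq_inner inner_simps inner_commute field_simps)
  qed
  obtain w where w: "\<And>w' r. (w', r) \<in> ?K \<Longrightarrow> r + w \<bullet> w' \<ge> 0 + (norm w)\<^sup>2 / 2"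
    using variational_inequality_quadratic[of ?K 0] lower maximally_monotone_nonempty[OF A] by auto
  obtain p q where pq: "w = (p, q)" by force
  \<comment> \<open>Adding \<open>p \<bullet> q\<close> to both sides of \<open>w\<close> completes
    the square on one side and factors the other.\<close>
  have key: "(norm (p + q))\<^sup>2 / 2 \<le> (y + q) \<bullet> (v + p)" if "(y, v) \<in> A" for y v
  proof -
    have "((y, v), y \<bullet> v) \<in> ?K" using that by (intro hull_inc) force
    from w[OF this] show ?thesis
      by (simp add: pq power2_norm_eq_inner inner_simps inner_commute)
  qed
  have mem: "(- q, - p) \<in> A"
  proof (rule maximally_monotone_memI[OF A])
    fix y v assume "(y, v) \<in> A"
    have "0 \<le> (norm (p + q))\<^sup>2 / 2" by simp
    also have "\<dots> \<le> (y + q) \<bullet> (v + p)" by (rule key) fact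
    also have "\<dots> = (- q - y) \<bullet> (- p - v)" by (simp add: inner_simps)
    finally show "0 \<le> (- q - y) \<bullet> (- p - v)" .
  qed
  \<comment> \<open>At \<open>(- q, - p)\<close> itself the right-hand side of \<open>key\<close> is
    zero.\<close>
  from key[OF mem] have "p + q = 0" by simp
  then have "p = - q" by (simp add: eq_neg_iff_add_eq_0)
  then show ?thesis using mem by (intro that[of "- q"]) simp
qed

theorem Minty:
  fixes A :: "('a::{real_inner, complete_space} \<times> 'a) set"
  assumes "maximally_monotone A" "\<mu> > 0"
  obtains x u where "(x, u) \<in> A" "x + \<mu> *\<^sub>R u = z"
proof -
  obtain y where "(y, - y) \<in> (\<lambda>(x, u). (x - z, \<mu> *\<^sub>R u)) ` A"
    using Minty_zero[OF maximally_monotone_scale_translate[OF assms]] by blast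
  then obtain x u where "(x, u) \<in> A" "y = x - z" "- y = \<mu> *\<^sub>R u" by auto
  moreover from this have "x + \<mu> *\<^sub>R u = z"
    by (metis add_diff_cancel_left' diff_add_cancel diff_minus_eq_add minus_diff_eq)
  ultimately show ?thesis using that by blast
qed

subsection \<open>Quadratic growth\<close>

text \<open>Each of \<open>n\<close> equal pieces of the segment contributes
  \<open>\<alpha> 1\<close>, and each is only \<open>1 / n\<close> of \<open>z - w\<close>;
  telescoping therefore gives a factor \<open>n * n\<close>. All division points have values because
  \<open>J\<close> is total.\<close>

lemma uniformly_monotone_quadratic_growth_1:
  assumes um: "uniformly_monotone \<alpha> (range (\<lambda>z. (z, J z)))"
    and "\<alpha> 1 > 0" and far: "norm (z - w) \<ge> 1"
  shows "\<alpha> 1 / 4 * (norm (z - w))\<^sup>2 \<le> (z - w) \<bullet> (J z - J w)"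
proof -
  define R where "R = norm (z - w)"
  \<comment> \<open>Rounding down keeps the piece length \<open>R / n\<close> at least 1.\<close>
  define n where "n = nat \<lfloor>R\<rfloor>"
  have n: "real n \<le> R" "R < real n + 1" "n \<ge> 1"
    using far unfolding n_def R_def by linarith+
  define p where "p i = w + (real i / n) *\<^sub>R (z - w)" for i
  have diff: "p (Suc i) - p i = (1 / n) *\<^sub>R (z - w)" for i
    by (simp add: p_def add_divide_distrib scaleR_left_distrib)
  have "\<alpha> 1 \<le> (1 / n) * ((z - w) \<bullet> (J (p (Suc i)) - J (p i)))" for i
  proof -
    have "norm (p (Suc i) - p i) \<ge> 1"
      unfolding diff norm_scaleR R_def[symmetric] using n by simp
    then have "\<alpha> 1 \<le> (p (Suc i) - p i) \<bullet> (J (p (Suc i)) - J (p i))"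
      by (intro uniformly_monotoneD[OF um]) auto
    then show ?thesis unfolding diff by simp
  qed
  then have "(\<Sum>i<n. \<alpha> 1) \<le> (\<Sum>i<n. (1 / n) * ((z - w) \<bullet> (J (p (Suc i)) - J (p i))))"
    by (intro sum_mono)
  also have "\<dots> = (1 / n) * ((z - w) \<bullet> (\<Sum>i<n. J (p (Suc i)) - J (p i)))"
    by (simp add: inner_sum_right sum_divide_distrib)
  also have "(\<Sum>i<n. J (p (Suc i)) - J (p i)) = J (p n) - J (p 0)"
    by (rule sum_lessThan_telescope)
  also have "\<dots> = J z - J w" using n by (simp add: p_def)
  finally have "real n * real n * \<alpha> 1 \<le> (z - w) \<bullet> (J z - J w)"
    using n by (simp add: field_simps)
  \<comment> \<open>\<open>R < n + 1 \<le> 2 * n\<close> is the source of the factor 1/4.\<close>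
  moreover have "R\<^sup>2 \<le> (2 * real n)\<^sup>2" using n by (intro power_mono) (auto simp: R_def)
  then have "\<alpha> 1 / 4 * R\<^sup>2 \<le> \<alpha> 1 / 4 * (2 * real n)\<^sup>2"
    using \<open>\<alpha> 1 > 0\<close> by (intro mult_left_mono) auto
  ultimately show ?thesis by (simp add: R_def power2_eq_square algebra_simps)
qed

lemma uniformly_monotone_quadratic_growth:
  assumes um: "uniformly_monotone \<alpha> (range (\<lambda>z. (z, J z)))"
    and pos: "\<And>\<epsilon>. \<epsilon> > 0 \<Longrightarrow> \<alpha> \<epsilon> > 0" and "\<epsilon> > 0" and far: "norm (z - w) \<ge> \<epsilon>"
  shows "\<beta>_mod \<alpha> \<epsilon> * (norm (z - w))\<^sup>2 \<le> (z - w) \<bullet> (J z - J w)"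
proof (cases "norm (z - w) \<ge> 1")
  case True
  have "\<beta>_mod \<alpha> \<epsilon> * (norm (z - w))\<^sup>2 \<le> \<alpha> 1 / 4 * (norm (z - w))\<^sup>2"
    by (intro mult_right_mono) (auto simp: \<beta>_mod_def)
  also have "\<dots> \<le> (z - w) \<bullet> (J z - J w)"
    using uniformly_monotone_quadratic_growth_1[OF um _ True] pos by simp
  finally show ?thesis .
next
  case False
  \<comment> \<open>Here \<open>\<epsilon> < 1\<close>, so \<open>\<beta>_mod\<close> is at most
    \<open>\<alpha> \<epsilon>\<close>, and the squared distance is at most 1.\<close>
  have "\<beta>_mod \<alpha> \<epsilon> * (norm (z - w))\<^sup>2 \<le> \<alpha> \<epsilon> * 1"
    using False far pos[OF \<open>\<epsilon> > 0\<close>]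
    by (intro mult_mono) (auto simp: \<beta>_mod_def power_le_one)
  also have "\<dots> \<le> (z - w) \<bullet> (J z - J w)"
    using uniformly_monotoneD[OF um _ _ \<open>\<epsilon> > 0\<close> far] by auto
  finally show ?thesis .
qed

subsection \<open>Maximally monotone, inverse uniformly monotone operators\<close>

locale inverse_uniformly_monotone_operator =
  fixes A :: "('a::{real_inner, complete_space} \<times> 'a) set" and \<psi> :: "real \<Rightarrow> real"
  assumes \<psi>_pos: "\<And>\<epsilon>. \<epsilon> > 0 \<Longrightarrow> \<psi> \<epsilon> > 0"
    and maximal: "maximally_monotone A"
    and ium: "inverse_uniformly_monotone \<psi> A"
begin

lemma monotone: "monotone_op A"
  using maximal by (simp add: maximally_monotone_def)

lemma \<alpha>_mod_pos: "\<epsilon> > 0 \<Longrightarrow> \<alpha>_mod \<psi> \<epsilon> > 0"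
  by (simp add: \<alpha>_mod_def \<psi>_pos)

text \<open>The positive root \<open>\<tau>\<close> of
  \<open>\<tau>\<^sup>2 + \<tau> = \<beta>\<close>; the first entry of the maximum in
  \<open>L_mod\<close> is \<open>2 * \<epsilon> / rate \<epsilon>\<close>.\<close>

definition rate :: "real \<Rightarrow> real" where
  "rate \<epsilon> = (sqrt (1 + 4 * \<beta>_mod (\<alpha>_mod \<psi>) \<epsilon>) - 1) / 2"

lemma \<beta>_mod_pos: "\<epsilon> > 0 \<Longrightarrow> \<beta>_mod (\<alpha>_mod \<psi>) \<epsilon> > 0"
  by (simp add: \<beta>_mod_def \<alpha>_mod_pos)

lemma rate_pos: "\<epsilon> > 0 \<Longrightarrow> rate \<epsilon> > 0"
  by (simp add: rate_def \<beta>_mod_pos)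

lemma rate_quadratic: "\<epsilon> > 0 \<Longrightarrow> (rate \<epsilon>)\<^sup>2 + rate \<epsilon> = \<beta>_mod (\<alpha>_mod \<psi>) \<epsilon>"
  using \<beta>_mod_pos[of \<epsilon>] by (simp add: rate_def power2_eq_square field_simps)

lemma quadratic_growth:
  assumes "(x, u) \<in> A" "(y, v) \<in> A" "\<epsilon> > 0" "norm (x + u - (y + v)) \<ge> \<epsilon>"
  shows "\<beta>_mod (\<alpha>_mod \<psi>) \<epsilon> * (norm (x + u - (y + v)))\<^sup>2 \<le> (x + u - (y + v)) \<bullet> (x - y)"
proof -
  have expand: "(x + u - (y + v)) \<bullet> (x - y) = (norm (x - y))\<^sup>2 + (u - v) \<bullet> (x - y)" for x y u v :: 'a
    by (simp add: power2_norm_eq_inner inner_simps)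
  \<comment> \<open>If the sums are \<open>\<epsilon>\<close> apart, then \<open>u - v\<close> or
    \<open>x - y\<close> has norm at least \<open>\<epsilon> / 2\<close>: these cases give the two
    entries of the minimum in \<open>\<alpha>_mod\<close>.\<close>
  have um: "\<alpha>_mod \<psi> \<epsilon> \<le> (x + u - (y + v)) \<bullet> (x - y)"
    if mem: "(x, u) \<in> A" "(y, v) \<in> A" and \<epsilon>: "\<epsilon> > 0" "norm (x + u - (y + v)) \<ge> \<epsilon>" for x u y v \<epsilon>
  proof (cases "norm (u - v) \<ge> \<epsilon> / 2")
    case True
    then show ?thesis
      using inverse_uniformly_monotoneD[OF ium mem, of "\<epsilon> / 2"] \<epsilon>
      unfolding expand \<alpha>_mod_def by (smt (verit) half_gt_zero zero_le_power2)
  next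
    case False
    then have "norm (x - y) \<ge> \<epsilon> / 2"
      using \<epsilon> norm_triangle_ineq[of "x - y" "u - v"] by (simp add: add_diff_add)
    then have "(norm (x - y))\<^sup>2 \<ge> (\<epsilon> / 2)\<^sup>2" using \<epsilon> by (intro power_mono) auto
    then show ?thesis
      using monotone_opD[OF monotone mem]
      unfolding expand \<alpha>_mod_def by (simp add: power_divide inner_commute)
  qed
  have "\<exists>x u. (x, u) \<in> A \<and> x + u = z" for z
    using Minty[OF maximal, of 1 z] by (metis scaleR_one zero_less_one)
  then obtain J U where J: "\<And>z. (J z, U z) \<in> A" "\<And>z. J z + U z = z" by metis
  \<comment> \<open>Pairs with equal sums have opposite differences, which monotonicity allows only
    if both vanish.\<close>
  have "J (x + u) = x" if "(x, u) \<in> A" for x u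
  proof -
    let ?z = "x + u"
    have "U ?z - u = - (J ?z - x)" using J(2)[of ?z] by (simp add: algebra_simps)
    then have "0 \<le> - ((norm (J ?z - x))\<^sup>2)"
      using monotone_opD[OF monotone J(1)[of ?z] that]
      by (simp only: power2_norm_eq_inner inner_minus_right)
    then show ?thesis by simp
  qed
  moreover have "uniformly_monotone (\<alpha>_mod \<psi>) (range (\<lambda>z. (z, J z)))"
    unfolding uniformly_monotone_def using um[OF J(1) J(1)] by (auto simp: J(2))
  ultimately show ?thesis
    using uniformly_monotone_quadratic_growth[of "\<alpha>_mod \<psi>" J \<epsilon> "x + u" "y + v"] assms \<alpha>_mod_pos
    by simp
qed

text \<open>A ratio below the positive root would make \<open>\<tau>\<^sup>2 + \<tau>\<close>
  smaller than \<open>\<beta>\<close>, against quadratic growth.\<close>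

lemma rate_mult_norm_le:
  assumes mem: "(x, u) \<in> A" "(y, v) \<in> A" and \<epsilon>: "\<epsilon> > 0" "norm (u - v) \<ge> \<epsilon>"
  shows "rate \<epsilon> * norm (u - v) \<le> norm (x - y)"
proof (rule ccontr)
  let ?d = "norm (x - y)" and ?D = "norm (u - v)" and ?R = "norm (x + u - (y + v))"
  let ?\<beta> = "\<beta>_mod (\<alpha>_mod \<psi>) \<epsilon>"
  assume "\<not> ?thesis"
  then have less: "?d < rate \<epsilon> * ?D" by simp
  have eq: "?R\<^sup>2 = ?d\<^sup>2 + 2 * ((x - y) \<bullet> (u - v)) + ?D\<^sup>2"
    by (simp add: power2_norm_eq_inner inner_simps inner_commute)
  \<comment> \<open>This carries the lower bound \<open>\<epsilon>\<close> over to the resolvent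
    arguments \<open>x + u\<close> and \<open>y + v\<close>.\<close>
  then have "?D\<^sup>2 \<le> ?R\<^sup>2" using monotone_opD[OF monotone mem] by (simp add: eq)
  then have "?D \<le> ?R" by (rule power2_le_imp_le) simp
  have "?\<beta> * ?D\<^sup>2 \<le> ?\<beta> * ?R\<^sup>2"
    using \<open>?D\<^sup>2 \<le> ?R\<^sup>2\<close> \<beta>_mod_pos[OF \<epsilon>(1)] by (intro mult_left_mono) auto
  also have "\<dots> \<le> (x + u - (y + v)) \<bullet> (x - y)"
    using quadratic_growth[OF mem \<epsilon>(1)] \<epsilon>(2) \<open>?D \<le> ?R\<close> by linarith
  also have "\<dots> = ?d\<^sup>2 + (x - y) \<bullet> (u - v)"
    by (simp add: power2_norm_eq_inner inner_simps inner_commute)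
  also have "\<dots> \<le> ?d\<^sup>2 + ?d * ?D"
    using norm_cauchy_schwarz by simp
  also have "\<dots> < (rate \<epsilon> * ?D)\<^sup>2 + rate \<epsilon> * ?D * ?D"
  proof (rule add_less_le_mono)
    show "?d\<^sup>2 < (rate \<epsilon> * ?D)\<^sup>2" using less by (intro power_strict_mono) auto
    show "?d * ?D \<le> rate \<epsilon> * ?D * ?D" using less by (intro mult_right_mono) auto
  qed
  also have "\<dots> = ((rate \<epsilon>)\<^sup>2 + rate \<epsilon>) * ?D\<^sup>2"
    by (simp add: power2_eq_square algebra_simps)
  finally show False by (simp add: rate_quadratic[OF \<epsilon>(1)])
qed

section \<open>Existence and uniqueness of values\<close>

lemma single_valued:
  assumes "(x, u) \<in> A" "(x, v) \<in> A"
  shows "u = v"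
proof (rule ccontr)
  assume "u \<noteq> v"
  then show False
    using inverse_uniformly_monotoneD[OF ium assms, of "norm (u - v)"] \<psi>_pos[of "norm (u - v)"]
    by simp
qed

text \<open>Minty solves the regularised equations with \<open>l n\<close> in place of
  \<open>\<mu>\<close>. The \<open>u n\<close> stay bounded, so \<open>y n\<close> tends to
  \<open>x\<close>; inverse uniform monotonicity then makes \<open>u\<close> Cauchy, and maximality
  puts the limit in the graph.\<close>

lemma ex_value: "\<exists>u. (x, u) \<in> A"
proof -
  define t where "t = rate 1"
  have t: "t > 0" by (simp add: t_def rate_pos)
  have coarse: "norm (u - v) \<le> 1 + norm (y - z) / t" if "(y, u) \<in> A" "(z, v) \<in> A" for y z u v
  proof (cases "norm (u - v) \<ge> 1")
    case True
    then show ?thesis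
      using rate_mult_norm_le[OF that, of 1] t by (simp add: t_def[symmetric] field_simps)
  next
    case False
    then show ?thesis using t by (smt (verit) divide_nonneg_pos norm_ge_zero)
  qed
  obtain c d where cd: "(c, d) \<in> A" using maximally_monotone_nonempty[OF maximal] by auto
  \<comment> \<open>With \<open>l n \<le> t / 2\<close>, the coarse bound for \<open>u n\<close>
    contains \<open>norm (u n)\<close> with factor at most 1/2, which is absorbed on the left; hence
    the factor 2 in \<open>M\<close>.\<close>
  define l where "l n = t / 2 / real (Suc n)" for n
  have l: "0 < l n" "l n \<le> t / 2" for n
    using t by (auto simp: l_def field_simps)
  have "l \<longlonglongrightarrow> t / 2 * 0"
    unfolding l_def divide_inverse[of _ "real _"]
    by (intro tendsto_intros LIMSEQ_inverse_real_of_nat)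
  then have l0: "l \<longlonglongrightarrow> 0" by simp
  have "\<exists>y u. (y, u) \<in> A \<and> y + l n *\<^sub>R u = x" for n
    using Minty[OF maximal l(1)] by metis
  then obtain y u where yu: "\<And>n. (y n, u n) \<in> A" "\<And>n. y n + l n *\<^sub>R u n = x" by metis
  define M where "M = 2 * (norm d + 1 + norm (x - c) / t)"
  have M: "norm (u n) \<le> M" for n
  proof -
    have "y n - c = (x - c) - l n *\<^sub>R u n" using yu(2)[of n] by (simp add: algebra_simps)
    then have "norm (y n - c) \<le> norm (x - c) + l n * norm (u n)"
      using norm_triangle_ineq4[of "x - c" "l n *\<^sub>R u n"] l(1)[of n]
      by (simp only: norm_scaleR abs_of_pos)
    also have "\<dots> \<le> norm (x - c) + t / 2 * norm (u n)"
      using l(2)[of n] by (intro add_left_mono mult_right_mono) auto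
    finally have "norm (y n - c) / t \<le> norm (x - c) / t + norm (u n) / 2"
      using t by (simp add: field_simps)
    moreover have "norm (u n) \<le> norm (u n - d) + norm d"
      using norm_triangle_ineq[of "u n - d" d] by simp
    ultimately show ?thesis
      using coarse[OF yu(1)[of n] cd] unfolding M_def by argo
  qed
  then have "M \<ge> 0" using norm_ge_zero order_trans by blast
  have dist: "norm (y n - x) \<le> l n * M" for n
  proof -
    have "y n - x = - (l n *\<^sub>R u n)" using yu(2)[of n] by (simp add: algebra_simps)
    then have "norm (y n - x) = l n * norm (u n)" using l(1)[of n] by simp
    then show ?thesis using M[of n] l(1)[of n] by (simp add: mult_left_mono)
  qed
  have ylim: "y \<longlonglongrightarrow> x"
  proof -
    have "(\<lambda>n. l n * M) \<longlonglongrightarrow> 0" using tendsto_mult_right[OF l0, of M] by simp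
    then have "(\<lambda>n. y n - x) \<longlonglongrightarrow> 0"
      by (rule Lim_null_comparison[rotated]) (simp add: dist)
    then show ?thesis by (simp add: LIM_zero_iff)
  qed
  have "Cauchy u"
  proof (rule CauchyI)
    fix e :: real assume "e > 0"
    \<comment> \<open>\<open>2 * M\<close> bounds \<open>norm (u i - u j)\<close>; the added 1 keeps
      the denominator positive when \<open>M = 0\<close>.\<close>
    have "\<psi> e / (2 * M + 1) > 0" using \<psi>_pos[OF \<open>e > 0\<close>] \<open>M \<ge> 0\<close> by simp
    then obtain N where N: "\<And>i j. i \<ge> N \<Longrightarrow> j \<ge> N \<Longrightarrow> norm (y i - y j) < \<psi> e / (2 * M + 1)"
      using CauchyD[OF LIMSEQ_imp_Cauchy[OF ylim]] by blast
    have "norm (u i - u j) < e" if ij: "i \<ge> N" "j \<ge> N" for i j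
    proof (rule ccontr)
      assume "\<not> ?thesis"
      then have "\<psi> e \<le> (u i - u j) \<bullet> (y i - y j)"
        using inverse_uniformly_monotoneD[OF ium yu(1) yu(1) \<open>e > 0\<close>] by simp
      also have "\<dots> \<le> norm (u i - u j) * norm (y i - y j)" by (rule norm_cauchy_schwarz)
      also have "\<dots> \<le> (2 * M + 1) * norm (y i - y j)"
        using norm_triangle_ineq4[of "u i" "u j"] M[of i] M[of j] by (intro mult_right_mono) auto
      also have "\<dots> < \<psi> e" using N[OF ij] \<open>M \<ge> 0\<close> by (simp add: field_simps)
      finally show False by simp
    qed
    then show "\<exists>N. \<forall>i\<ge>N. \<forall>j\<ge>N. norm (u i - u j) < e" by blast
  qed
  then obtain v where ulim: "u \<longlonglongrightarrow> v" using Cauchy_convergent convergent_def by blast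
  have "(x, v) \<in> A"
  proof (rule maximally_monotone_memI[OF maximal])
    fix a b assume ab: "(a, b) \<in> A"
    have "(\<lambda>n. (y n - a) \<bullet> (u n - b)) \<longlonglongrightarrow> (x - a) \<bullet> (v - b)"
      by (intro tendsto_intros ylim ulim)
    then show "0 \<le> (x - a) \<bullet> (v - b)"
      by (rule LIMSEQ_le_const) (use monotone_opD[OF monotone yu(1) ab] in auto)
  qed
  then show ?thesis ..
qed

text \<open>Ensures that the definite description in \<open>op_value\<close> denotes.\<close>

lemma op_value_mem: "(x, op_value A x) \<in> A"
  unfolding op_value_def using ex_value[of x] single_valued by (auto intro: theI)

text \<open>Both entries of the minimum in \<open>\<gamma>_mod\<close> act:
  \<open>norm (x - y) < \<epsilon>\<close> bounds \<open>norm (u - v)\<close> by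
  \<open>L_mod \<psi> \<epsilon>\<close>, and then
  \<open>norm (x - y) < \<psi> \<epsilon> / L_mod \<psi> \<epsilon>\<close> contradicts inverse
  uniform monotonicity.\<close>

lemma norm_less_of_norm_less_\<gamma>_mod:
  assumes mem: "(x, u) \<in> A" "(y, v) \<in> A" and "\<epsilon> > 0" and close: "norm (x - y) < \<gamma>_mod \<psi> \<epsilon>"
  shows "norm (u - v) < \<epsilon>"
proof (rule ccontr)
  assume "\<not> ?thesis"
  then have far: "norm (u - v) \<ge> \<epsilon>" by simp
  let ?L = "L_mod \<psi> \<epsilon>"
  have t: "rate \<epsilon> > 0" using rate_pos \<open>\<epsilon> > 0\<close> .
  have L: "?L = max (2 * \<epsilon> / rate \<epsilon>) (2 * \<epsilon>)"
    by (simp add: L_mod_def rate_def)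
  then have "?L > 0" using \<open>\<epsilon> > 0\<close> by simp
  have "norm (u - v) \<le> norm (x - y) / rate \<epsilon>"
    using rate_mult_norm_le[OF mem \<open>\<epsilon> > 0\<close> far] t by (simp add: field_simps)
  also have "\<dots> \<le> 2 * \<epsilon> / rate \<epsilon>"
    using close t \<open>\<epsilon> > 0\<close> by (intro divide_right_mono) (auto simp: \<gamma>_mod_def)
  finally have "norm (u - v) \<le> ?L" unfolding L by simp
  have "\<psi> \<epsilon> \<le> (u - v) \<bullet> (x - y)"
    by (rule inverse_uniformly_monotoneD[OF ium mem \<open>\<epsilon> > 0\<close> far])
  also have "\<dots> \<le> norm (u - v) * norm (x - y)" by (rule norm_cauchy_schwarz)
  also have "\<dots> \<le> ?L * norm (x - y)" using \<open>norm (u - v) \<le> ?L\<close> by (simp add: mult_right_mono)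
  also have "\<dots> < \<psi> \<epsilon>" using close \<open>?L > 0\<close> by (simp add: \<gamma>_mod_def field_simps)
  finally show False by simp
qed

end

theorem proposition3p13:
  fixes A :: "('a::{real_inner, complete_space} \<times> 'a) set"
    and \<psi> :: "real \<Rightarrow> real"
  assumes "\<And>\<epsilon>. \<epsilon> > 0 \<Longrightarrow> \<psi> \<epsilon> > 0"
    and "maximally_monotone A"
    and "inverse_uniformly_monotone \<psi> A"
  shows "\<forall>\<epsilon>>0. \<forall>x y :: 'a. norm (x - y) < \<gamma>_mod \<psi> \<epsilon> \<longrightarrow>
           norm (op_value A x - op_value A y) < \<epsilon>"
proof -
  interpret inverse_uniformly_monotone_operator A \<psi>
    using assms by unfold_locales
  show ?thesis using norm_less_of_norm_less_\<gamma>_mod op_value_mem by blast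
qed

end
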